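(* Let $\mathcal F$ be a filter on $\omega$. Then the Mathias forcing $\mathbb M_{\mathcal F}$ is almost $\omega^\omega$-bounding if and only if $\mathcal F$ has the Hurewicz property (as a subspace of $\mathcal P(\omega)$).
   Context: A filter on $\omega$ is a family $\mathcal F\subset[\omega]^\omega$ (of infinite subsets of $\omega$) that contains all co-finite subsets of $\omega$ and is closed under finite intersections of its elements and under supersets. $\mathcal P(\omega)$ carries the topology of the Cantor space $2^\omega$ via characteristic functions; subsets of it carry the subspace topology. $\mathbb M_{\mathcal F}$ consists of pairs $\langle s,F\rangle$ with $s\in[\omega]^{<\omega}$, $F\in\mathcal F$, and $\max s<\min F$ (no requirement if $s=\emptyset$). A condition $\langle s,F\rangle$ is stronger than $\langle t,G\rangle$ if $F\subset G$, $s$ is an end-extension of $t$, and $s\setminus t\subset G$. A poset $\mathbb P$ is almost $\omega^\omega$-bounding if for every $\mathbb P$-name $\dot f$ for a real (element of $\omega^\omega$) and every $q\in\mathbb P$ there exists $g:\omega\to\omega$ (in the ground model) such that for every (ground model) $A\in[\omega]^\omega$ there is $q_A\le q$ (i.e. stronger than $q$) with $q_A\Vdash g\restriction A\not<^*\dot f\restriction A$. Here $g\restriction A<^*f\restriction A$ means $g(n)<f(n)$ for all but finitely many $n\in A$. A topological space $X$ has the Hurewicz property if for every sequence $\langle\mathcal U_n:n\in\omega\rangle$ of open covers of $X$ there are finite $\mathcal V_n\subset\mathcal U_n$ ($n\in\omega$) such that every $x\in X$ belongs to $\bigcup\mathcal V_n$ for all but finitely many $n$. *)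

theory Defs
  imports "HOL-Analysis.Analysis"
begin

subsection \<open>Filters on \<open>\<omega>\<close> and the Hurewicz property\<close>

definition omega_filter :: "nat set set \<Rightarrow> bool" where
  "omega_filter F \<longleftrightarrow>
     (\<forall>A\<in>F. infinite A) \<and>
     (\<forall>A. finite (- A) \<longrightarrow> A \<in> F) \<and>
     (\<forall>A\<in>F. \<forall>B\<in>F. A \<inter> B \<in> F) \<and>
     (\<forall>A\<in>F. \<forall>B. A \<subseteq> B \<longrightarrow> B \<in> F)"

definition cantor_space :: "(nat \<Rightarrow> bool) topology" where
  "cantor_space = product_topology (\<lambda>_. discrete_topology UNIV) UNIV"

definition powerset_topology :: "nat set topology" where
  "powerset_topology = pullback_topology UNIV (\<lambda>A n. n \<in> A) cantor_space"

definition open_cover :: "'a topology \<Rightarrow> 'a set set \<Rightarrow> bool" where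
  "open_cover X \<U> \<longleftrightarrow> (\<forall>U\<in>\<U>. openin X U) \<and> \<Union>\<U> = topspace X"

definition hurewicz_space :: "'a topology \<Rightarrow> bool" where
  "hurewicz_space X \<longleftrightarrow>
     (\<forall>\<U> :: nat \<Rightarrow> 'a set set. (\<forall>n. open_cover X (\<U> n)) \<longrightarrow>
        (\<exists>\<V> :: nat \<Rightarrow> 'a set set. (\<forall>n. finite (\<V> n) \<and> \<V> n \<subseteq> \<U> n) \<and>
            (\<forall>x\<in>topspace X. finite {n. x \<notin> \<Union>(\<V> n)})))"

subsection \<open>Forcing statements about a name for a real\<close>

text \<open>
  A poset is a carrier \<open>P\<close> with a relation \<open>le\<close>, where \<open>le p q\<close> means that \<open>p\<close> is stronger
  than \<open>q\<close>.  The ground model is the ambient universe of sets and functions.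

  An element of \<open>\<omega>\<^sup>\<omega>\<close> of the extension is a subset of the ground model set \<open>\<omega> \<times> \<omega>\<close>, hence it
  has a name consisting of pairs \<open>\<langle>(n,m)\<check>, p\<rangle>\<close>; such a name is coded by the set of the
  corresponding \<open>((n, m), p)\<close>.
\<close>

type_synonym 'p name = "((nat \<times> nat) \<times> 'p) set"

text \<open>
  The sentences of the forcing language in which one name \<open>f\<close> occurs.  \<open>Ground b\<close> is a statement
  about ground model objects, with truth value \<open>b\<close>; \<open>Val n m\<close> says \<open>(n, m) \<in> f\<close>;
  \<open>Forall \<phi>\<close> quantifies over \<open>\<omega>\<close>, which is the same set in the ground model and in the extension.
\<close>

datatype sentence =
    Ground bool
  | Val nat nat
  | Neg sentence
  | Conj sentence sentence
  | Forall "nat \<Rightarrow> sentence"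

definition Imp :: "sentence \<Rightarrow> sentence \<Rightarrow> sentence" where
  "Imp \<phi> \<psi> = Neg (Conj \<phi> (Neg \<psi>))"

definition Exists :: "(nat \<Rightarrow> sentence) \<Rightarrow> sentence" where
  "Exists \<phi> = Neg (Forall (\<lambda>n. Neg (\<phi> n)))"

text \<open>
  The usual recursive definition of the forcing relation.  In the clause for \<open>Val\<close>, the
  conditions lying below some \<open>p'\<close> with \<open>((n, m), p') \<in> f\<close> are required to be dense below \<open>p\<close>.
\<close>

primrec forces ::
  "'p set \<Rightarrow> ('p \<Rightarrow> 'p \<Rightarrow> bool) \<Rightarrow> 'p name \<Rightarrow> 'p \<Rightarrow> sentence \<Rightarrow> bool" where
  "forces P le f p (Ground b) \<longleftrightarrow> b"
| "forces P le f p (Val n m) \<longleftrightarrow>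
     (\<forall>q\<in>P. le q p \<longrightarrow> (\<exists>r\<in>P. le r q \<and> (\<exists>p'. ((n, m), p') \<in> f \<and> le r p')))"
| "forces P le f p (Neg \<phi>) \<longleftrightarrow> (\<forall>q\<in>P. le q p \<longrightarrow> \<not> forces P le f q \<phi>)"
| "forces P le f p (Conj \<phi> \<psi>) \<longleftrightarrow> forces P le f p \<phi> \<and> forces P le f p \<psi>"
| "forces P le f p (Forall \<phi>) \<longleftrightarrow> (\<forall>n. forces P le f p (\<phi> n))"

definition total_function :: sentence where
  "total_function = Forall (\<lambda>n. Exists (\<lambda>m. Val n m))"

definition single_valued_function :: sentence where
  "single_valued_function =
     Forall (\<lambda>n. Forall (\<lambda>m. Forall (\<lambda>k. Imp (Conj (Val n m) (Val n k)) (Ground (m = k)))))"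

definition real_name :: "'p set \<Rightarrow> ('p \<Rightarrow> 'p \<Rightarrow> bool) \<Rightarrow> 'p name \<Rightarrow> bool" where
  "real_name P le f \<longleftrightarrow>
     f \<subseteq> UNIV \<times> P \<and>
     (\<forall>p\<in>P. forces P le f p (Conj total_function single_valued_function))"

text \<open>
  \<open>g\<restriction>A <\<^sup>* f\<restriction>A\<close>: there is \<open>k\<close> such that \<open>g n < f n\<close> for all \<open>n \<in> A\<close> with \<open>n \<ge> k\<close>, where
  \<open>g n < f n\<close> is written as the existence of a value \<open>m > g n\<close> of \<open>f\<close> at \<open>n\<close>.
\<close>

definition eventually_below :: "(nat \<Rightarrow> nat) \<Rightarrow> nat set \<Rightarrow> sentence" where
  "eventually_below g A =
     Exists (\<lambda>k. Forall (\<lambda>n. Imp (Ground (n \<in> A \<and> k \<le> n))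
       (Exists (\<lambda>m. Conj (Val n m) (Ground (g n < m))))))"

definition almost_bounding :: "'p set \<Rightarrow> ('p \<Rightarrow> 'p \<Rightarrow> bool) \<Rightarrow> bool" where
  "almost_bounding P le \<longleftrightarrow>
     (\<forall>f. \<forall>q\<in>P. real_name P le f \<longrightarrow>
        (\<exists>g :: nat \<Rightarrow> nat. \<forall>A :: nat set. infinite A \<longrightarrow>
           (\<exists>q\<^sub>A\<in>P. le q\<^sub>A q \<and> forces P le f q\<^sub>A (Neg (eventually_below g A)))))"

subsection \<open>Mathias forcing of a filter\<close>

definition mathias :: "nat set set \<Rightarrow> (nat set \<times> nat set) set" where
  "mathias \<F> = {(s, F). finite s \<and> F \<in> \<F> \<and> (s \<noteq> {} \<longrightarrow> Max s < Inf F)}"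

definition end_extension :: "nat set \<Rightarrow> nat set \<Rightarrow> bool" where
  "end_extension s t \<longleftrightarrow> t \<subseteq> s \<and> (\<forall>i\<in>t. \<forall>j\<in>s - t. i < j)"

definition mathias_le :: "nat set \<times> nat set \<Rightarrow> nat set \<times> nat set \<Rightarrow> bool" where
  "mathias_le = (\<lambda>(s, F) (t, G). F \<subseteq> G \<and> end_extension s t \<and> s - t \<subseteq> G)"

end

theory Submission
  imports Defs "HOL-Library.Nat_Bijection"
begin

text \<open>
  Both sides of the equivalence are compared with a purely combinatorial statement about the
  filter \<open>\<F>\<close>.  Call a family \<open>C\<close> of finite sets \<^emph>\<open>positive\<close> if every member of \<open>\<F>\<close> includes an
  element of \<open>C\<close>.  The combinatorial Hurewicz property says that from positive \<open>C 0, C 1, \<dots>\<close> one can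
  choose finite \<open>D n \<subseteq> C n\<close> such that every member of \<open>\<F>\<close> includes an element of \<open>D n\<close> for all but
  finitely many \<open>n\<close>.

  \<^emph>\<open>Topology.\<close>  A positive family \<open>C\<close> gives the open cover of \<open>\<F>\<close> by the sets
  \<open>{Y \<in> \<F>. s \<subseteq> Y}\<close> with \<open>s \<in> C\<close>.  Conversely, for \<open>X \<in> \<F>\<close> the set of all \<open>Y \<supseteq> X\<close> is a compact
  subset of \<open>\<F>\<close>, so finitely many members of a given open cover of \<open>\<F>\<close> cover it, and they then
  already cover \<open>{Y \<in> \<F>. s \<subseteq> Y}\<close> for some finite \<open>s \<subseteq> X\<close> (\<open>finite_subcover_above_finite_part\<close>).
  Hence the finite sets \<open>s\<close> for which \<open>{Y \<in> \<F>. s \<subseteq> Y}\<close> is finitely covered form a positive family,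
  and the two Hurewicz properties agree (\<open>hurewicz_space_iff_filter_hurewicz\<close>).

  \<^emph>\<open>From the Hurewicz property to bounding.\<close>  Given a name \<open>f\<close>, let \<open>C n\<close> consist of the finite sets
  \<open>t\<close> such that every stem \<open>s \<subseteq> {..<n}\<close> can be prolonged by a subset of \<open>t\<close> to the stem of a condition
  that decides \<open>f n\<close>.  As there are only finitely many such stems, density of the deciding conditions
  makes \<open>C n\<close> positive.  Let \<open>g n\<close> bound the finitely many values that come from \<open>D n\<close>.  For every
  condition \<open>(s, X)\<close> and all but finitely many \<open>n\<close>, the set \<open>X\<close> includes some \<open>t \<in> D n\<close>, so
  \<open>(s, X)\<close> has an extension forcing \<open>f n \<le> g n\<close>.

  \<^emph>\<open>From bounding to the Hurewicz property.\<close>  Given positive families \<open>C n\<close>, let \<open>f n\<close> be the least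
  code of an element of \<open>C n\<close> that is included in \<open>x - {..<n}\<close>, where \<open>x\<close> is the Mathias real.
  If \<open>g\<close> is as in the definition of almost bounding, let \<open>D n\<close> be the set of elements of \<open>C n\<close> with
  code at most \<open>g n\<close>.  Suppose that \<open>X \<in> \<F>\<close> includes no element of \<open>D n\<close> for infinitely many \<open>n\<close>, and let
  \<open>A\<close> be the set of these \<open>n\<close>.  Below any condition there is one that forces \<open>x - {..<n} \<subseteq> X\<close> for all
  large \<open>n\<close>, and hence \<open>f n > g n\<close> for all large \<open>n \<in> A\<close>, which contradicts the choice of \<open>g\<close>.
\<close>

section \<open>The Hurewicz property of a filter in terms of finite sets\<close>

definition positive :: "nat set set \<Rightarrow> nat set set \<Rightarrow> bool" where
  "positive \<F> C \<longleftrightarrow> (\<forall>s\<in>C. finite s) \<and> (\<forall>X\<in>\<F>. \<exists>s\<in>C. s \<subseteq> X)"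

definition filter_hurewicz :: "nat set set \<Rightarrow> bool" where
  "filter_hurewicz \<F> \<longleftrightarrow>
     (\<forall>C. (\<forall>n. positive \<F> (C n)) \<longrightarrow>
        (\<exists>D. (\<forall>n::nat. finite (D n) \<and> D n \<subseteq> C n) \<and>
             (\<forall>X\<in>\<F>. finite {n. \<not> (\<exists>s\<in>D n. s \<subseteq> X)})))"

lemma openin_powerset_topology_iff:
  "openin powerset_topology U \<longleftrightarrow>
     (\<forall>X\<in>U. \<exists>n. \<forall>Y. Y \<inter> {..<n} = X \<inter> {..<n} \<longrightarrow> Y \<in> U)"
proof
  assume "openin powerset_topology U"
  then obtain V where V: "openin cantor_space V" and U: "U = (\<lambda>A n. n \<in> A) -` V"
    unfolding powerset_topology_def openin_pullback_topology by auto
  show "\<forall>X\<in>U. \<exists>n. \<forall>Y. Y \<inter> {..<n} = X \<inter> {..<n} \<longrightarrow> Y \<in> U"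
  proof
    fix X assume "X \<in> U"
    then have "(\<lambda>n. n \<in> X) \<in> V" using U by auto
    with V obtain B where B: "finite {i. B i \<noteq> (UNIV :: bool set)}"
        "(\<lambda>n. n \<in> X) \<in> Pi\<^sub>E UNIV B" "Pi\<^sub>E UNIV B \<subseteq> V"
      unfolding cantor_space_def openin_product_topology_alt by fastforce
    obtain n where n: "\<forall>i\<in>{i. B i \<noteq> UNIV}. i < n"
      using B(1) finite_nat_set_iff_bounded by blast
    have "Y \<in> U" if "Y \<inter> {..<n} = X \<inter> {..<n}" for Y
    proof -
      have "(i \<in> Y) \<in> B i" for i
      proof (cases "i < n")
        case True
        then have "(i \<in> Y) = (i \<in> X)" using that by blast
        then show ?thesis using B(2) by (auto simp: PiE_iff)
      next
        case False
        then have "B i = UNIV" using n by blast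
        then show ?thesis by simp
      qed
      then have "(\<lambda>n. n \<in> Y) \<in> Pi\<^sub>E UNIV B" by (auto simp: PiE_iff)
      then show ?thesis using B(3) U by auto
    qed
    then show "\<exists>n. \<forall>Y. Y \<inter> {..<n} = X \<inter> {..<n} \<longrightarrow> Y \<in> U" by blast
  qed
next
  assume *: "\<forall>X\<in>U. \<exists>n. \<forall>Y. Y \<inter> {..<n} = X \<inter> {..<n} \<longrightarrow> Y \<in> U"
  have "openin cantor_space {h. Collect h \<in> U}"
    unfolding cantor_space_def openin_product_topology_alt
  proof safe
    fix h assume "Collect h \<in> U"
    with * obtain n where n: "\<And>Y. Y \<inter> {..<n} = Collect h \<inter> {..<n} \<Longrightarrow> Y \<in> U" by blast
    define B where "B i = (if i < n then {h i} else UNIV)" for i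
    have "{i. B i \<noteq> UNIV} \<subseteq> {..<n}" by (auto simp: B_def)
    then have "finite {i. B i \<noteq> UNIV}" by (rule finite_subset) simp
    moreover have "h \<in> Pi\<^sub>E UNIV B" by (auto simp: B_def)
    moreover have "Pi\<^sub>E UNIV B \<subseteq> {h. Collect h \<in> U}"
    proof
      fix k assume k: "k \<in> Pi\<^sub>E UNIV B"
      have "k i = h i" if "i < n" for i
        using k that by (auto simp: B_def PiE_iff dest: spec[of _ i])
      then have "Collect k \<inter> {..<n} = Collect h \<inter> {..<n}" by auto
      then show "k \<in> {h. Collect h \<in> U}" using n by blast
    qed
    ultimately show "\<exists>B. finite {i \<in> UNIV. B i \<noteq> topspace (discrete_topology UNIV)} \<and>
         (\<forall>i\<in>UNIV. openin (discrete_topology UNIV) (B i)) \<and>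
         h \<in> Pi\<^sub>E UNIV B \<and> Pi\<^sub>E UNIV B \<subseteq> {h. Collect h \<in> U}"
      by (intro exI[of _ B]) auto
  qed
  moreover have "U = (\<lambda>A n. n \<in> A) -` {h. Collect h \<in> U} \<inter> UNIV" by auto
  ultimately show "openin powerset_topology U"
    unfolding powerset_topology_def openin_pullback_topology by blast
qed

lemma topspace_powerset_topology [simp]: "topspace powerset_topology = UNIV"
  unfolding powerset_topology_def topspace_pullback_topology cantor_space_def by simp

lemma compact_space_powerset_topology: "compact_space powerset_topology"
proof -
  have "continuous_map cantor_space powerset_topology Collect"
    unfolding powerset_topology_def
    by (rule continuous_map_pullback') (auto simp: comp_def)
  moreover have "compactin cantor_space UNIV"
    using compact_space_product_topology[of "\<lambda>_::nat. discrete_topology (UNIV :: bool set)" UNIV]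
    unfolding compact_space_def cantor_space_def by (simp add: compactin_discrete_topology)
  ultimately have "compactin powerset_topology (range Collect)"
    by (rule image_compactin[rotated])
  moreover have "range Collect = (UNIV :: nat set set)"
    by (auto intro: range_eqI[of _ _ "\<lambda>n. n \<in> _"])
  ultimately show ?thesis by (simp add: compact_space_def)
qed

text \<open>
  This is the tube lemma for the compact set of all supersets of \<open>X\<close>.  The map \<open>Z \<mapsto> X \<union> Z\<close> retracts
  the whole power set onto that set, so it suffices to use compactness of the power set itself, with
  the preimages of the basic open sets under this retraction.
\<close>

lemma finite_subcover_above_finite_part:
  assumes up: "\<And>Y. X \<subseteq> Y \<Longrightarrow> Y \<in> \<F>"
    and cover: "open_cover (subtopology powerset_topology \<F>) \<U>"
  shows "\<exists>n \<V>. finite \<V> \<and> \<V> \<subseteq> \<U> \<and> {Y\<in>\<F>. X \<inter> {..<n} \<subseteq> Y} \<subseteq> \<Union>\<V>"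
proof -
  have "\<exists>U n. U \<in> \<U> \<and> (\<forall>Y\<in>\<F>. Y \<inter> {..<n} = (X \<union> Z) \<inter> {..<n} \<longrightarrow> Y \<in> U)" for Z
  proof -
    have "X \<union> Z \<in> \<Union>\<U>" using cover up[of "X \<union> Z"] by (auto simp: open_cover_def)
    then obtain U where U: "U \<in> \<U>" "X \<union> Z \<in> U" by blast
    then obtain W where W: "openin powerset_topology W" "U = W \<inter> \<F>"
      using cover by (auto simp: open_cover_def openin_subtopology)
    then obtain n where "\<forall>Y. Y \<inter> {..<n} = (X \<union> Z) \<inter> {..<n} \<longrightarrow> Y \<in> W"
      using U(2) unfolding openin_powerset_topology_iff by blast
    then show ?thesis using U(1) W(2) by (intro exI[of _ U] exI[of _ n]) simp
  qed
  then obtain U n where U: "\<And>Z. U Z \<in> \<U>"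
      and n: "\<And>Z Y. Y \<in> \<F> \<Longrightarrow> Y \<inter> {..<n Z} = (X \<union> Z) \<inter> {..<n Z} \<Longrightarrow> Y \<in> U Z"
    by metis
  define cyl where "cyl Z = {Y. (X \<union> Y) \<inter> {..<n Z} = (X \<union> Z) \<inter> {..<n Z}}" for Z
  have "openin powerset_topology (cyl Z)" for Z
    unfolding openin_powerset_topology_iff
  proof (intro ballI exI allI impI)
    fix Y Y' assume "Y \<in> cyl Z" "Y' \<inter> {..<n Z} = Y \<inter> {..<n Z}"
    then show "Y' \<in> cyl Z" unfolding cyl_def by blast
  qed
  moreover have "topspace powerset_topology \<subseteq> \<Union>(range cyl)"
    by (auto simp: cyl_def)
  ultimately obtain \<K> where K: "finite \<K>" "\<K> \<subseteq> range cyl" "UNIV \<subseteq> \<Union>\<K>"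
    using compact_space_powerset_topology[unfolded compact_space_alt, rule_format, of "range cyl"]
    by auto
  obtain T where "finite T" "\<K> = cyl ` T"
    using finite_subset_image[OF K(1,2)] by blast
  then have T: "finite T" "UNIV = \<Union>(cyl ` T)" using K(3) by auto
  define N where "N = Max (insert 0 (n ` T))"
  have N: "n Z \<le> N" if "Z \<in> T" for Z
    using T(1) that by (auto simp: N_def)
  have "{Y\<in>\<F>. X \<inter> {..<N} \<subseteq> Y} \<subseteq> \<Union>(U ` T)"
  proof safe
    fix Y assume Y: "Y \<in> \<F>" "X \<inter> {..<N} \<subseteq> Y"
    obtain Z where Z: "Z \<in> T" "Y \<in> cyl Z" using T(2) by blast
    have "Y \<inter> {..<n Z} = (X \<union> Y) \<inter> {..<n Z}" using Y(2) N[OF Z(1)] by auto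
    then have "Y \<in> U Z" using n[OF Y(1)] Z(2) by (simp add: cyl_def)
    then show "Y \<in> \<Union>(U ` T)" using Z(1) by blast
  qed
  then show ?thesis using T(1) U by (intro exI[of _ N] exI[of _ "U ` T"]) auto
qed

lemma hurewicz_space_iff_filter_hurewicz:
  assumes up: "\<And>X Y. X \<in> \<F> \<Longrightarrow> X \<subseteq> Y \<Longrightarrow> Y \<in> \<F>"
  shows "hurewicz_space (subtopology powerset_topology \<F>) \<longleftrightarrow> filter_hurewicz \<F>"
proof
  assume H: "hurewicz_space (subtopology powerset_topology \<F>)"
  show "filter_hurewicz \<F>"
    unfolding filter_hurewicz_def
  proof (intro allI impI)
    fix C :: "nat \<Rightarrow> nat set set" assume C: "\<forall>n. positive \<F> (C n)"
    let ?up = "\<lambda>s. {Y\<in>\<F>. s \<subseteq> Y}"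
    have "openin (subtopology powerset_topology \<F>) (?up s)" if "finite s" for s
    proof -
      obtain n where n: "s \<subseteq> {..<n}" using \<open>finite s\<close> finite_nat_iff_bounded by blast
      have "openin powerset_topology {Y. s \<subseteq> Y}"
        unfolding openin_powerset_topology_iff using n by blast
      moreover have "?up s = {Y. s \<subseteq> Y} \<inter> \<F>" by blast
      ultimately show ?thesis unfolding openin_subtopology by blast
    qed
    then have "open_cover (subtopology powerset_topology \<F>) (?up ` C n)" for n
      using C unfolding open_cover_def positive_def by fastforce
    then obtain \<V> where V: "\<And>n. finite (\<V> n) \<and> \<V> n \<subseteq> ?up ` C n"
        and fin: "\<forall>x\<in>topspace (subtopology powerset_topology \<F>). finite {n. x \<notin> \<Union>(\<V> n)}"
      using H[unfolded hurewicz_space_def, rule_format, of "\<lambda>n. ?up ` C n"] by blast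
    have "\<forall>n. \<exists>D. D \<subseteq> C n \<and> finite D \<and> \<V> n = ?up ` D"
      using V by (meson finite_subset_image)
    then obtain D where D: "\<And>n. D n \<subseteq> C n \<and> finite (D n) \<and> \<V> n = ?up ` D n" by metis
    have "finite {n. \<not> (\<exists>s\<in>D n. s \<subseteq> X)}" if "X \<in> \<F>" for X
    proof -
      have "{n. \<not> (\<exists>s\<in>D n. s \<subseteq> X)} = {n. X \<notin> \<Union>(\<V> n)}" using D that by auto
      then show ?thesis using fin that by simp
    qed
    then show "\<exists>D. (\<forall>n. finite (D n) \<and> D n \<subseteq> C n) \<and>
        (\<forall>X\<in>\<F>. finite {n. \<not> (\<exists>s\<in>D n. s \<subseteq> X)})"
      using D by (intro exI[of _ D]) simp
  qed
next
  assume H: "filter_hurewicz \<F>"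
  show "hurewicz_space (subtopology powerset_topology \<F>)"
    unfolding hurewicz_space_def
  proof (intro allI impI)
    fix \<U> :: "nat \<Rightarrow> nat set set set"
    assume cover: "\<forall>n. open_cover (subtopology powerset_topology \<F>) (\<U> n)"
    define C where "C n = {s. finite s \<and>
        (\<exists>\<V>. finite \<V> \<and> \<V> \<subseteq> \<U> n \<and> {Y\<in>\<F>. s \<subseteq> Y} \<subseteq> \<Union>\<V>)}" for n
    have "positive \<F> (C n)" for n
      unfolding positive_def
    proof (intro conjI ballI)
      fix X assume "X \<in> \<F>"
      then obtain m \<V> where "finite \<V>" "\<V> \<subseteq> \<U> n" "{Y\<in>\<F>. X \<inter> {..<m} \<subseteq> Y} \<subseteq> \<Union>\<V>"
        using finite_subcover_above_finite_part[OF _ cover[rule_format, of n], of X] up by metis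
      then have "X \<inter> {..<m} \<in> C n" unfolding C_def by auto
      then show "\<exists>s\<in>C n. s \<subseteq> X" by blast
    qed (simp add: C_def)
    then obtain D where D: "\<And>n. finite (D n) \<and> D n \<subseteq> C n"
        and fin: "\<And>X. X \<in> \<F> \<Longrightarrow> finite {n. \<not> (\<exists>s\<in>D n. s \<subseteq> X)}"
      using H unfolding filter_hurewicz_def by meson
    have "\<forall>n. \<forall>s\<in>C n. \<exists>\<V>. finite \<V> \<and> \<V> \<subseteq> \<U> n \<and> {Y\<in>\<F>. s \<subseteq> Y} \<subseteq> \<Union>\<V>"
      unfolding C_def by blast
    then obtain W where W: "\<And>n s. s \<in> C n \<Longrightarrow>
        finite (W n s) \<and> W n s \<subseteq> \<U> n \<and> {Y\<in>\<F>. s \<subseteq> Y} \<subseteq> \<Union>(W n s)"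
      by metis
    define \<V> where "\<V> n = (\<Union>s\<in>D n. W n s)" for n
    have "finite (\<V> n) \<and> \<V> n \<subseteq> \<U> n" for n
      using D[of n] W[of _ n] unfolding \<V>_def by blast
    moreover have "finite {n. X \<notin> \<Union>(\<V> n)}" if "X \<in> \<F>" for X
    proof (rule finite_subset[OF _ fin[OF that]])
      show "{n. X \<notin> \<Union>(\<V> n)} \<subseteq> {n. \<not> (\<exists>s\<in>D n. s \<subseteq> X)}"
      proof safe
        fix n s assume "X \<notin> \<Union>(\<V> n)" "s \<in> D n" "s \<subseteq> X"
        moreover from this have "X \<in> \<Union>(W n s)" using D[of n] W[of s n] that by blast
        ultimately show False unfolding \<V>_def by blast
      qed
    qed
    ultimately show "\<exists>\<V>. (\<forall>n. finite (\<V> n) \<and> \<V> n \<subseteq> \<U> n) \<and>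
        (\<forall>x\<in>topspace (subtopology powerset_topology \<F>). finite {n. x \<notin> \<Union>(\<V> n)})"
      by (intro exI[of _ \<V>]) simp
  qed
qed

section \<open>The forcing relation over a preorder\<close>

locale forcing_preorder =
  fixes P :: "'p set" and le :: "'p \<Rightarrow> 'p \<Rightarrow> bool"
  assumes le_refl: "p \<in> P \<Longrightarrow> le p p"
    and le_trans: "le p q \<Longrightarrow> le q r \<Longrightarrow> le p r"
begin

lemma forces_mono: "forces P le f p \<phi> \<Longrightarrow> le q p \<Longrightarrow> forces P le f q \<phi>"
  by (induction \<phi>) (auto intro: le_trans)

lemma forces_Exists:
  "forces P le f p (Exists \<phi>) \<longleftrightarrow>
     (\<forall>q\<in>P. le q p \<longrightarrow> (\<exists>r\<in>P. le r q \<and> (\<exists>n. forces P le f r (\<phi> n))))"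
  unfolding Exists_def forces.simps using le_refl le_trans by blast

lemma forces_Imp_Ground:
  "forces P le f p (Imp (Ground b) \<psi>) \<longleftrightarrow>
     (b \<longrightarrow> (\<forall>q\<in>P. le q p \<longrightarrow> (\<exists>r\<in>P. le r q \<and> forces P le f r \<psi>)))"
  by (auto simp: Imp_def)

text \<open>
  Being a function is forced by all conditions, so it may be tested locally: totality says that the
  conditions deciding the value at \<open>n\<close> are dense, and uniqueness of values can be read off from each
  single condition, because a condition that forces two distinct values would have no extension
  forcing \<open>Ground (m = k)\<close>.
\<close>

lemma real_name_iff:
  "real_name P le f \<longleftrightarrow> f \<subseteq> UNIV \<times> P \<and>
     (\<forall>p\<in>P. \<forall>n. \<exists>r\<in>P. le r p \<and> (\<exists>m. forces P le f r (Val n m))) \<and>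
     (\<forall>p\<in>P. \<forall>n m k. forces P le f p (Val n m) \<longrightarrow> forces P le f p (Val n k) \<longrightarrow> m = k)"
proof -
  have "(\<forall>p\<in>P. forces P le f p total_function) \<longleftrightarrow>
      (\<forall>p\<in>P. \<forall>n. \<exists>r\<in>P. le r p \<and> (\<exists>m. forces P le f r (Val n m)))"
    unfolding total_function_def forces.simps(5) forces_Exists
    using le_refl by blast
  moreover have "(\<forall>p\<in>P. forces P le f p single_valued_function) \<longleftrightarrow>
      (\<forall>p\<in>P. \<forall>n m k. forces P le f p (Val n m) \<longrightarrow> forces P le f p (Val n k) \<longrightarrow> m = k)"
    unfolding single_valued_function_def forces.simps(1,3,4,5) Imp_def
    using le_refl by blast
  ultimately show ?thesis unfolding real_name_def forces.simps(4) ball_conj_distrib by argo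
qed

text \<open>
  The nested negations in the sentence collapse by density.  What remains is that no condition
  below \<open>p\<close> and no \<open>k\<close> can prevent a small value at some later \<open>n \<in> A\<close>, since some extension decides
  such a value.
\<close>

lemma forces_not_eventually_below_iff:
  assumes f: "real_name P le f" and p: "p \<in> P"
  shows "forces P le f p (Neg (eventually_below g A)) \<longleftrightarrow>
     (\<forall>q\<in>P. le q p \<longrightarrow>
        (\<forall>k. \<exists>n\<in>A. k \<le> n \<and> (\<exists>r\<in>P. le r q \<and> (\<exists>m\<le>g n. forces P le f r (Val n m)))))"
    (is "?L \<longleftrightarrow> ?R")
proof
  assume L: ?L
  show ?R
  proof (intro ballI impI allI, rule ccontr)
    fix q k assume q: "q \<in> P" "le q p"
      and "\<not> (\<exists>n\<in>A. k \<le> n \<and> (\<exists>r\<in>P. le r q \<and> (\<exists>m\<le>g n. forces P le f r (Val n m))))"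
    then have large: "g n < m" if "n \<in> A" "k \<le> n" "r \<in> P" "le r q" "forces P le f r (Val n m)"
      for n r m using that by (meson not_le)
    have ex: "forces P le f r (Exists (\<lambda>m. Conj (Val n m) (Ground (g n < m))))"
      if "n \<in> A" "k \<le> n" "r \<in> P" "le r q" for n r
      unfolding forces_Exists
    proof (intro ballI impI)
      fix r' assume r': "r' \<in> P" "le r' r"
      then obtain r'' m where "r'' \<in> P" "le r'' r'" "forces P le f r'' (Val n m)"
        using f unfolding real_name_iff by blast
      moreover have "le r'' q" using calculation r' that le_trans by blast
      ultimately show "\<exists>r''\<in>P. le r'' r' \<and>
          (\<exists>m. forces P le f r'' (Conj (Val n m) (Ground (g n < m))))"
        using large[OF that(1,2)] by (metis forces.simps(1,4))
    qed
    have "forces P le f r (Forall (\<lambda>n. Imp (Ground (n \<in> A \<and> k \<le> n))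
        (Exists (\<lambda>m. Conj (Val n m) (Ground (g n < m))))))" if r: "r \<in> P" "le r q" for r
      unfolding forces.simps(5) forces_Imp_Ground
    proof (intro allI impI ballI)
      fix n r' assume "n \<in> A \<and> k \<le> n" "r' \<in> P" "le r' r"
      then show "\<exists>s\<in>P. le s r' \<and>
          forces P le f s (Exists (\<lambda>m. Conj (Val n m) (Ground (g n < m))))"
        using ex[of n r'] le_refl le_trans[OF _ r(2)] by blast
    qed
    then have "forces P le f q (eventually_below g A)"
      unfolding eventually_below_def forces_Exists using le_refl by blast
    then show False using L q by simp
  qed
next
  assume R: ?R
  have "\<not> forces P le f q (eventually_below g A)" if q: "q \<in> P" "le q p" for q
  proof
    assume "forces P le f q (eventually_below g A)"
    then obtain r k where r: "r \<in> P" "le r q" and k: "\<And>n. forces P le f r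
        (Imp (Ground (n \<in> A \<and> k \<le> n)) (Exists (\<lambda>m. Conj (Val n m) (Ground (g n < m)))))"
      unfolding eventually_below_def forces_Exists forces.simps(5) using le_refl[OF q(1)] q(1) by meson
    obtain n r' m where n: "n \<in> A" "k \<le> n" and r': "r' \<in> P" "le r' r"
        and m: "m \<le> g n" "forces P le f r' (Val n m)"
      using R r q le_trans by blast
    obtain s where s: "s \<in> P" "le s r'"
        "forces P le f s (Exists (\<lambda>m. Conj (Val n m) (Ground (g n < m))))"
      using k[of n] n r' unfolding forces_Imp_Ground by blast
    then obtain u m' where u: "u \<in> P" "le u s" "forces P le f u (Val n m')" "g n < m'"
      unfolding forces_Exists using le_refl by auto
    have "forces P le f u (Val n m)" using m(2) s(2) u(2) forces_mono le_trans by blast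
    then have "m = m'" using f u unfolding real_name_iff by blast
    then show False using m(1) u(4) by simp
  qed
  then show ?L by simp
qed

end

section \<open>Mathias conditions\<close>

lemma end_extension_refl: "end_extension s s"
  by (simp add: end_extension_def)

lemma end_extension_trans: "end_extension s t \<Longrightarrow> end_extension t u \<Longrightarrow> end_extension s u"
  unfolding end_extension_def by blast

interpretation mathias: forcing_preorder "mathias \<F>" mathias_le for \<F>
proof
  show "mathias_le p p" for p
    by (cases p) (simp add: mathias_le_def end_extension_refl)
  show "mathias_le p r" if "mathias_le p q" "mathias_le q r" for p q r
    using that unfolding mathias_le_def by (auto split: prod.splits intro: end_extension_trans)
qed

lemma omega_filter_infinite: "omega_filter \<F> \<Longrightarrow> X \<in> \<F> \<Longrightarrow> infinite X"
  unfolding omega_filter_def by (elim conjE) blast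

lemma omega_filter_cofinite: "omega_filter \<F> \<Longrightarrow> finite (- X) \<Longrightarrow> X \<in> \<F>"
  unfolding omega_filter_def by (elim conjE) blast

lemma omega_filter_Int: "omega_filter \<F> \<Longrightarrow> X \<in> \<F> \<Longrightarrow> Y \<in> \<F> \<Longrightarrow> X \<inter> Y \<in> \<F>"
  unfolding omega_filter_def by (elim conjE) blast

lemma omega_filter_up: "omega_filter \<F> \<Longrightarrow> X \<in> \<F> \<Longrightarrow> X \<subseteq> Y \<Longrightarrow> Y \<in> \<F>"
  unfolding omega_filter_def by (elim conjE) blast

lemma mathias_iff:
  assumes "omega_filter \<F>"
  shows "(s, X) \<in> mathias \<F> \<longleftrightarrow> finite s \<and> X \<in> \<F> \<and> (\<forall>i\<in>s. \<forall>j\<in>X. i < j)"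
proof (cases "X \<in> \<F> \<and> finite s \<and> s \<noteq> {}")
  case True
  then have "infinite X" using assms omega_filter_infinite by blast
  then have "X \<noteq> {}" by auto
  then have "n < Inf X \<longleftrightarrow> (\<forall>j\<in>X. n < j)" for n
    using Inf_nat_def1[of X] wellorder_Inf_le1[of _ X] by (meson less_le_trans)
  then show ?thesis using True by (auto simp: mathias_def)
qed (auto simp: mathias_def)

lemma omega_filter_tail:
  assumes "omega_filter \<F>" "X \<in> \<F>"
  shows "X \<inter> {n..} \<in> \<F>"
proof -
  have "{n..} \<in> \<F>" by (rule omega_filter_cofinite[OF assms(1)]) simp
  then show ?thesis by (rule omega_filter_Int[OF assms])
qed

lemma mathias_prolong:
  assumes "omega_filter \<F>" "(s, X) \<in> mathias \<F>" "finite t" "t \<subseteq> s \<union> X"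
  shows "\<exists>Y\<subseteq>X. (s \<union> t, Y) \<in> mathias \<F> \<and> mathias_le (s \<union> t, Y) (s, X)"
proof -
  obtain n where n: "t \<subseteq> {..<n}" using assms(3) finite_nat_iff_bounded by blast
  have "(s \<union> t, X \<inter> {n..}) \<in> mathias \<F>"
    using assms n omega_filter_tail[OF assms(1), of X n]
    unfolding mathias_iff[OF assms(1)] by fastforce
  moreover have "mathias_le (s \<union> t, X \<inter> {n..}) (s, X)"
    using assms unfolding mathias_iff[OF assms(1)] mathias_le_def end_extension_def by auto
  ultimately show ?thesis by blast
qed

section \<open>The Hurewicz property implies almost bounding\<close>

lemma finite_uniform_bound:
  fixes Q :: "'a \<Rightarrow> nat \<Rightarrow> bool"
  assumes "finite S" "\<And>x. x \<in> S \<Longrightarrow> \<exists>k. Q x k"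
  shows "\<exists>b. \<forall>x\<in>S. \<exists>k\<le>b. Q x k"
proof -
  obtain h where "\<And>x. x \<in> S \<Longrightarrow> Q x (h x)" using assms(2) by metis
  moreover have "\<forall>x\<in>S. h x \<le> Max (h ` S)" using assms(1) by simp
  ultimately show ?thesis by blast
qed

text \<open>
  The function \<open>g\<close> depends neither on \<open>A\<close> nor on the condition: every condition forces infinitely
  often on \<open>A\<close> that the real is bounded by \<open>g\<close>.
\<close>

lemma filter_hurewicz_imp_almost_bounding:
  assumes F: "omega_filter \<F>" and H: "filter_hurewicz \<F>"
  shows "almost_bounding (mathias \<F>) mathias_le"
  unfolding almost_bounding_def
proof (intro allI ballI impI)
  fix f q assume q: "q \<in> mathias \<F>" and f: "real_name (mathias \<F>) mathias_le f"
  let ?forces = "forces (mathias \<F>) mathias_le f"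
  define dec where "dec n t s k \<longleftrightarrow> (\<exists>u\<subseteq>t. u \<subseteq> {n..} \<and>
      (\<exists>G. (s \<union> u, G) \<in> mathias \<F> \<and> ?forces (s \<union> u, G) (Val n k)))" for n t s k
  define C where "C n = {t. finite t \<and> (\<forall>s\<subseteq>{..<n}. \<exists>k. dec n t s k)}" for n
  have "positive \<F> (C n)" for n
    unfolding positive_def
  proof (intro conjI ballI)
    fix X assume X: "X \<in> \<F>"
    have "\<exists>t k. finite t \<and> t \<subseteq> X \<and> dec n t s k" if "s \<subseteq> {..<n}" for s
    proof -
      have fin: "finite s" using that finite_subset by blast
      have "(s, X \<inter> {n..}) \<in> mathias \<F>"
        using omega_filter_tail[OF F X] that fin unfolding mathias_iff[OF F] by fastforce
      then obtain r k where r: "r \<in> mathias \<F>" "mathias_le r (s, X \<inter> {n..})" "?forces r (Val n k)"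
        using f unfolding mathias.real_name_iff by blast
      obtain v G where v: "r = (v, G)" by (cases r)
      have "s \<union> (v - s) = v" "v - s \<subseteq> X \<inter> {n..}"
        using r(2) unfolding v mathias_le_def end_extension_def by auto
      moreover have "finite v" using r(1) unfolding v mathias_iff[OF F] by simp
      moreover have "dec n (v - s) s k"
        unfolding dec_def using calculation r v by (intro exI[of _ "v - s"]) auto
      ultimately show ?thesis by blast
    qed
    then obtain T K where T: "\<And>s. s \<subseteq> {..<n} \<Longrightarrow> finite (T s) \<and> T s \<subseteq> X \<and> dec n (T s) s (K s)"
      by metis
    define t where "t = (\<Union>s\<in>Pow {..<n}. T s)"
    have "dec n t s (K s)" if "s \<subseteq> {..<n}" for s
    proof -
      have "T s \<subseteq> t" using that unfolding t_def by blast
      then show ?thesis using T[OF that] unfolding dec_def by (meson order_trans)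
    qed
    moreover have "finite t" "t \<subseteq> X" using T unfolding t_def by auto
    ultimately show "\<exists>t\<in>C n. t \<subseteq> X" unfolding C_def by blast
  qed (simp add: C_def)
  then obtain D where D: "\<And>n. finite (D n) \<and> D n \<subseteq> C n"
      and fin: "\<And>X. X \<in> \<F> \<Longrightarrow> finite {n. \<not> (\<exists>s\<in>D n. s \<subseteq> X)}"
    using H unfolding filter_hurewicz_def by meson
  have "\<exists>b. \<forall>x\<in>D n \<times> Pow {..<n}. \<exists>k\<le>b. dec n (fst x) (snd x) k" for n
    using D[of n] by (intro finite_uniform_bound) (auto simp: C_def)
  then obtain g where g: "\<And>n t s. t \<in> D n \<Longrightarrow> s \<subseteq> {..<n} \<Longrightarrow> \<exists>k\<le>g n. dec n t s k"
    by (metis PowI SigmaI fst_conv snd_conv)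
  have "?forces q (Neg (eventually_below g A))" if A: "infinite A" for A
    unfolding mathias.forces_not_eventually_below_iff[OF f q]
  proof (intro ballI impI allI)
    fix p k assume p: "p \<in> mathias \<F>"
    obtain s X where sX: "p = (s, X)" by (cases p)
    have s: "finite s" "X \<in> \<F>" "\<forall>i\<in>s. \<forall>j\<in>X. i < j"
      using p unfolding sX mathias_iff[OF F] by auto
    obtain N where N: "s \<subseteq> {..<N}" using s(1) finite_nat_iff_bounded by blast
    have "infinite (A - ({n. \<not> (\<exists>t\<in>D n. t \<subseteq> X)} \<union> {..<k + N}))"
      using A fin[OF s(2)] by (simp add: Diff_infinite_finite)
    then obtain n where n: "n \<in> A - ({n. \<not> (\<exists>t\<in>D n. t \<subseteq> X)} \<union> {..<k + N})"
      using infinite_imp_nonempty by blast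
    then obtain t where t: "t \<in> D n" "t \<subseteq> X" by blast
    have sn: "s \<subseteq> {..<n}" using N n by auto
    obtain m u G where m: "m \<le> g n" and u: "u \<subseteq> t" "u \<subseteq> {n..}"
        and G: "(s \<union> u, G) \<in> mathias \<F>" "?forces (s \<union> u, G) (Val n m)"
      using g[OF t(1) sn] unfolding dec_def by blast
    have "(s \<union> u, X \<inter> G) \<in> mathias \<F>"
      using G(1) s(2) omega_filter_Int[OF F] unfolding mathias_iff[OF F] by blast
    moreover have "mathias_le (s \<union> u, X \<inter> G) p"
      using u t(2) s(3) sn unfolding sX mathias_le_def end_extension_def by auto
    moreover have "mathias_le (s \<union> u, X \<inter> G) (s \<union> u, G)"
      by (simp add: mathias_le_def end_extension_refl)
    then have "?forces (s \<union> u, X \<inter> G) (Val n m)"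
      using G(2) mathias.forces_mono by blast
    ultimately show "\<exists>n\<in>A. k \<le> n \<and>
        (\<exists>r\<in>mathias \<F>. mathias_le r p \<and> (\<exists>m\<le>g n. ?forces r (Val n m)))"
      using n m by (intro bexI[of _ n]) auto
  qed
  then show "\<exists>g. \<forall>A. infinite A \<longrightarrow> (\<exists>q\<^sub>A\<in>mathias \<F>. mathias_le q\<^sub>A q \<and>
      ?forces q\<^sub>A (Neg (eventually_below g A)))"
    using q mathias.le_refl by blast
qed

section \<open>Almost bounding implies the Hurewicz property\<close>

definition captures :: "(nat \<Rightarrow> nat set set) \<Rightarrow> nat \<Rightarrow> nat \<Rightarrow> nat set \<Rightarrow> bool" where
  "captures C n m X \<longleftrightarrow> set_decode m \<in> C n \<and> set_decode m \<subseteq> X \<inter> {n..}"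

text \<open>
  A name for the function that maps \<open>n\<close> to the least code of an element of \<open>C n\<close> included in
  \<open>x - {..<n}\<close>, where \<open>x\<close> is the Mathias real.  As a condition \<open>(s, X)\<close> forces \<open>s \<subseteq> x \<subseteq> s \<union> X\<close>, the
  two requirements say that it forces the set with code \<open>m\<close> to qualify and all smaller codes not to.
\<close>

definition least_capture :: "nat set set \<Rightarrow> (nat \<Rightarrow> nat set set) \<Rightarrow> (nat set \<times> nat set) name" where
  "least_capture \<F> C = {((n, m), (s, X)) | n m s X. (s, X) \<in> mathias \<F> \<and>
     captures C n m s \<and> (\<forall>m'<m. \<not> captures C n m' (s \<union> X))}"

lemma captures_mono: "captures C n m X \<Longrightarrow> X \<subseteq> Y \<Longrightarrow> captures C n m Y"
  unfolding captures_def by blast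

lemma least_capture_below:
  assumes "((n, m), p) \<in> least_capture \<F> C" "mathias_le (u, H) p"
  shows "captures C n m u" "\<And>m'. m' < m \<Longrightarrow> \<not> captures C n m' u"
proof -
  obtain s X where p: "p = (s, X)" by (cases p)
  have "s \<subseteq> u" "u \<subseteq> s \<union> X"
    using assms(2) unfolding p mathias_le_def end_extension_def by auto
  then show "captures C n m u" "\<And>m'. m' < m \<Longrightarrow> \<not> captures C n m' u"
    using assms(1) captures_mono unfolding p least_capture_def by blast+
qed

lemma forces_least_captureD:
  assumes "p \<in> mathias \<F>" "forces (mathias \<F>) mathias_le (least_capture \<F> C) p (Val n m)"
  shows "\<exists>u H. (u, H) \<in> mathias \<F> \<and> mathias_le (u, H) p \<and> captures C n m u"
proof -
  obtain r p' where r: "r \<in> mathias \<F>" "mathias_le r p"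
      "((n, m), p') \<in> least_capture \<F> C" "mathias_le r p'"
    using assms mathias.le_refl[OF assms(1)] by auto
  then show ?thesis using least_capture_below(1) by (cases r) blast
qed

text \<open>
  Positivity of \<open>C n\<close> is what makes the name total: the reservoir of any condition still includes a
  set in \<open>C n\<close>, which can be moved into the stem.
\<close>

lemma real_name_least_capture:
  assumes F: "omega_filter \<F>" and C: "\<And>n. positive \<F> (C n)"
  shows "real_name (mathias \<F>) mathias_le (least_capture \<F> C)"
  unfolding mathias.real_name_iff
proof (intro conjI ballI allI impI)
  show "least_capture \<F> C \<subseteq> UNIV \<times> mathias \<F>" by (auto simp: least_capture_def)
next
  fix p n assume p: "p \<in> mathias \<F>"
  obtain s X where sX: "p = (s, X)" by (cases p)
  have "X \<inter> {n..} \<in> \<F>" using p omega_filter_tail[OF F] unfolding sX mathias_iff[OF F] by blast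
  then obtain t where t: "t \<in> C n" "finite t" "t \<subseteq> X \<inter> {n..}"
    using C unfolding positive_def by blast
  then have "captures C n (set_encode t) (s \<union> X)"
    unfolding captures_def by auto
  \<comment> \<open>The least code that can still be captured; adding its set to the stem decides the value.\<close>
  then obtain m where m: "captures C n m (s \<union> X)" "\<And>m'. m' < m \<Longrightarrow> \<not> captures C n m' (s \<union> X)"
    using exists_least_iff[of "\<lambda>m. captures C n m (s \<union> X)"] by blast
  obtain Y where Y: "Y \<subseteq> X" "(s \<union> set_decode m, Y) \<in> mathias \<F>"
      "mathias_le (s \<union> set_decode m, Y) (s, X)"
    using mathias_prolong[OF F p[unfolded sX], of "set_decode m"] m(1)
    unfolding captures_def by auto
  have "s \<union> set_decode m \<union> Y \<subseteq> s \<union> X" using Y(1) m(1) unfolding captures_def by blast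
  then have "\<not> captures C n m' (s \<union> set_decode m \<union> Y)" if "m' < m" for m'
    using m(2)[OF that] captures_mono by blast
  moreover have "captures C n m (s \<union> set_decode m)"
    using m(1) unfolding captures_def by blast
  ultimately have "((n, m), (s \<union> set_decode m, Y)) \<in> least_capture \<F> C"
    using Y(2) unfolding least_capture_def by simp
  then have "forces (mathias \<F>) mathias_le (least_capture \<F> C) (s \<union> set_decode m, Y) (Val n m)"
    using mathias.le_refl by auto
  then show "\<exists>r\<in>mathias \<F>. mathias_le r p \<and>
      (\<exists>m. forces (mathias \<F>) mathias_le (least_capture \<F> C) r (Val n m))"
    using Y sX by blast
next
  fix p n m k assume p: "p \<in> mathias \<F>"
    and m: "forces (mathias \<F>) mathias_le (least_capture \<F> C) p (Val n m)"
    and k: "forces (mathias \<F>) mathias_le (least_capture \<F> C) p (Val n k)"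
  obtain r p' where r: "r \<in> mathias \<F>" "mathias_le r p"
      "((n, m), p') \<in> least_capture \<F> C" "mathias_le r p'"
    using m p mathias.le_refl[OF p] by auto
  obtain r' p'' where r': "r' \<in> mathias \<F>" "mathias_le r' r"
      "((n, k), p'') \<in> least_capture \<F> C" "mathias_le r' p''"
    using k r(1,2) by auto
  obtain u H where u: "r' = (u, H)" by (cases r')
  have "mathias_le (u, H) p'" using r(4) r'(2) u mathias.le_trans by blast
  \<comment> \<open>Both numbers are the least code captured by the same stem.\<close>
  then show "m = k"
    using least_capture_below[OF r(3)] least_capture_below[OF r'(3)] r'(4) u
    by (metis linorder_neqE_nat)
qed

lemma almost_bounding_imp_filter_hurewicz:
  assumes F: "omega_filter \<F>" and B: "almost_bounding (mathias \<F>) mathias_le"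
  shows "filter_hurewicz \<F>"
  unfolding filter_hurewicz_def
proof (intro allI impI)
  fix C :: "nat \<Rightarrow> nat set set"
  assume C: "\<forall>n. positive \<F> (C n)"
  let ?f = "least_capture \<F> C"
  have f: "real_name (mathias \<F>) mathias_le ?f" using real_name_least_capture[OF F] C by blast
  have "({}, UNIV) \<in> mathias \<F>" using omega_filter_cofinite[OF F] unfolding mathias_iff[OF F] by simp
  then obtain g where g: "\<And>A. infinite A \<Longrightarrow> \<exists>p\<in>mathias \<F>.
      forces (mathias \<F>) mathias_le ?f p (Neg (eventually_below g A))"
    using B f unfolding almost_bounding_def by meson
  define D where "D n = set_decode ` {m. m \<le> g n \<and> set_decode m \<in> C n}" for n
  have "finite (D n) \<and> D n \<subseteq> C n" for n by (auto simp: D_def)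
  moreover have "finite {n. \<not> (\<exists>s\<in>D n. s \<subseteq> X)}" if X: "X \<in> \<F>" for X
  proof (rule ccontr)
    let ?A = "{n. \<not> (\<exists>s\<in>D n. s \<subseteq> X)}"
    assume "infinite ?A"
    then obtain p where p: "p \<in> mathias \<F>"
        and forced: "forces (mathias \<F>) mathias_le ?f p (Neg (eventually_below g ?A))"
      using g by blast
    obtain s G where sG: "p = (s, G)" by (cases p)
    have s: "finite s" using p unfolding sG mathias_iff[OF F] by simp
    obtain N where N: "s \<subseteq> {..<N}" using s finite_nat_iff_bounded by blast
    \<comment> \<open>Below this condition, the Mathias real is included in \<open>X\<close> from \<open>N\<close> on.\<close>
    have q: "(s, G \<inter> X) \<in> mathias \<F>" "mathias_le (s, G \<inter> X) p"
      using p X omega_filter_Int[OF F] end_extension_refl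
      unfolding sG mathias_iff[OF F] mathias_le_def by auto
    then obtain n r m where n: "n \<in> ?A" "N \<le> n" and r: "r \<in> mathias \<F>" "mathias_le r (s, G \<inter> X)"
        and m: "m \<le> g n" "forces (mathias \<F>) mathias_le ?f r (Val n m)"
      using forced unfolding mathias.forces_not_eventually_below_iff[OF f p] by blast
    obtain u H where u: "mathias_le (u, H) r" "captures C n m u"
      using forces_least_captureD[OF r(1) m(2)] by blast
    have "mathias_le (u, H) (s, G \<inter> X)" using u(1) r(2) mathias.le_trans by blast
    then have "u \<subseteq> {..<N} \<union> X" using N unfolding mathias_le_def by auto
    then have "set_decode m \<subseteq> X" using u(2) n(2) unfolding captures_def by fastforce
    moreover have "set_decode m \<in> D n" using u(2) m(1) unfolding captures_def D_def by blast
    ultimately show False using n(1) by blast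
  qed
  ultimately show "\<exists>D. (\<forall>n. finite (D n) \<and> D n \<subseteq> C n) \<and>
      (\<forall>X\<in>\<F>. finite {n. \<not> (\<exists>s\<in>D n. s \<subseteq> X)})"
    by (intro exI[of _ D]) simp
qed

theorem theorem1p4:
  fixes \<F> :: "nat set set"
  assumes "omega_filter \<F>"
  shows "almost_bounding (mathias \<F>) mathias_le
         \<longleftrightarrow> hurewicz_space (subtopology powerset_topology \<F>)"
  using hurewicz_space_iff_filter_hurewicz[of \<F>] omega_filter_up[OF assms]
    filter_hurewicz_imp_almost_bounding[OF assms] almost_bounding_imp_filter_hurewicz[OF assms]
  by blast

end
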